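(* Let $(\mathcal{C},\otimes,\mathbb{I})$ be a monoidal category. 1) If the unit object $\mathbb{I}$ is terminal in $\mathcal{C}$, then $\mathcal{C}$ is pre-rigid, where $X^*:=\mathbb{I}$ for every object $X$ in $\mathcal{C}$. 2) If the unit object $\mathbb{I}$ is initial in $\mathcal{C}$ and $\mathcal{C}$ is pre-rigid, then $\mathbb{I}$ is terminal in $\mathcal{C}$. 3) If the unit object $\mathbb{I}$ is initial in $\mathcal{C}$ and the skeleton of $\mathcal{C}$ is not the trivial category, then $\mathcal{C}$ is not right closed.
   Context: A monoidal category $(\mathcal{C},\otimes,\mathbb{I})$ is (right) pre-rigid if for every object $X$ there are an object $X^*$ (a pre-dual of $X$) and a morphism $\mathrm{ev}_X:X^*\otimes X\to\mathbb{I}$ such that for every object $T$ the map $\mathrm{Hom}_{\mathcal{C}}(T,X^* )\to\mathrm{Hom}_{\mathcal{C}}(T\otimes X,\mathbb{I})$, $u\mapsto \mathrm{ev}_X\circ(u\otimes X)$, is bijective. Here $X$ also denotes the identity morphism of $X$. No braiding is assumed. $\mathcal{C}$ is right closed if for every object $X$ the functor $(-)\otimes X:\mathcal{C}\to\mathcal{C}$ has a right adjoint. The trivial category is the category with one object and one morphism. *)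

theory Defs
  imports Main
begin

section \<open>Categories\<close>

record ('o, 'm) cat =
  Obj :: "'o set"
  Arr :: "'m set"
  Dom :: "'m \<Rightarrow> 'o"
  Cod :: "'m \<Rightarrow> 'o"
  Idn :: "'o \<Rightarrow> 'm"
  Comp :: "'m \<Rightarrow> 'm \<Rightarrow> 'm"  (infixr "\<cdot>\<index>" 75)

text \<open>Composition is written in applicative order: \<open>g \<cdot> f\<close> is ``first \<open>f\<close>, then \<open>g\<close>''. The maps
  \<open>Dom\<close>, \<open>Cod\<close>, \<open>Idn\<close> and \<open>Comp\<close> are only meaningful on objects, arrows and composable pairs.\<close>

definition Hom :: "('o, 'm, 'z) cat_scheme \<Rightarrow> 'o \<Rightarrow> 'o \<Rightarrow> 'm set" where
  "Hom C X Y = {f \<in> Arr C. Dom C f = X \<and> Cod C f = Y}"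

locale category =
  fixes C :: "('o, 'm, 'z) cat_scheme" (structure)
  assumes dom_obj: "f \<in> Arr C \<Longrightarrow> Dom C f \<in> Obj C"
    and cod_obj: "f \<in> Arr C \<Longrightarrow> Cod C f \<in> Obj C"
    and idn_hom: "X \<in> Obj C \<Longrightarrow> Idn C X \<in> Hom C X X"
    and comp_hom: "\<lbrakk>f \<in> Hom C X Y; g \<in> Hom C Y Z\<rbrakk> \<Longrightarrow> g \<cdot> f \<in> Hom C X Z"
    and comp_idn_right: "f \<in> Hom C X Y \<Longrightarrow> f \<cdot> Idn C X = f"
    and comp_idn_left: "f \<in> Hom C X Y \<Longrightarrow> Idn C Y \<cdot> f = f"
    and comp_assoc: "\<lbrakk>f \<in> Hom C W X; g \<in> Hom C X Y; h \<in> Hom C Y Z\<rbrakk>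
      \<Longrightarrow> (h \<cdot> g) \<cdot> f = h \<cdot> (g \<cdot> f)"

definition iso_arr :: "('o, 'm, 'z) cat_scheme \<Rightarrow> 'o \<Rightarrow> 'o \<Rightarrow> 'm \<Rightarrow> bool" where
  "iso_arr C X Y f \<longleftrightarrow> f \<in> Hom C X Y \<and>
     (\<exists>g \<in> Hom C Y X. g \<cdot>\<^bsub>C\<^esub> f = Idn C X \<and> f \<cdot>\<^bsub>C\<^esub> g = Idn C Y)"

definition isomorphic :: "('o, 'm, 'z) cat_scheme \<Rightarrow> 'o \<Rightarrow> 'o \<Rightarrow> bool" where
  "isomorphic C X Y \<longleftrightarrow> (\<exists>f. iso_arr C X Y f)"

definition initial_obj :: "('o, 'm, 'z) cat_scheme \<Rightarrow> 'o \<Rightarrow> bool" where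
  "initial_obj C A \<longleftrightarrow> A \<in> Obj C \<and> (\<forall>X \<in> Obj C. \<exists>!f. f \<in> Hom C A X)"

definition terminal_obj :: "('o, 'm, 'z) cat_scheme \<Rightarrow> 'o \<Rightarrow> bool" where
  "terminal_obj C A \<longleftrightarrow> A \<in> Obj C \<and> (\<forall>X \<in> Obj C. \<exists>!f. f \<in> Hom C X A)"

definition trivial_category :: "('o, 'm, 'z) cat_scheme \<Rightarrow> bool" where
  "trivial_category C \<longleftrightarrow> category C \<and> (\<exists>!X. X \<in> Obj C) \<and> (\<exists>!f. f \<in> Arr C)"

definition full_subcategory :: "('o, 'm, 'z) cat_scheme \<Rightarrow> 'o set \<Rightarrow> ('o, 'm) cat" where
  "full_subcategory C A =
     \<lparr> Obj = A, Arr = {f \<in> Arr C. Dom C f \<in> A \<and> Cod C f \<in> A},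
       Dom = Dom C, Cod = Cod C, Idn = Idn C, Comp = Comp C \<rparr>"

text \<open>A skeleton is a full subcategory with exactly one object from every isomorphism class.
  Any two skeletons of \<open>C\<close> are isomorphic categories,
  so a property invariant under isomorphism of categories does not depend on the choice.\<close>

definition is_skeleton :: "('o, 'm, 'z) cat_scheme \<Rightarrow> ('o, 'm) cat \<Rightarrow> bool" where
  "is_skeleton C S \<longleftrightarrow>
     (\<exists>A. A \<subseteq> Obj C \<and> (\<forall>X \<in> Obj C. \<exists>!Y. Y \<in> A \<and> isomorphic C X Y) \<and>
          S = full_subcategory C A)"


context category
begin

lemma isomorphic_refl: "X \<in> Obj C \<Longrightarrow> isomorphic C X X"
  unfolding isomorphic_def iso_arr_def by (metis idn_hom comp_idn_left)

lemma isomorphic_sym: "isomorphic C X Y \<Longrightarrow> isomorphic C Y X"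
  unfolding isomorphic_def iso_arr_def by blast

lemma isomorphic_trans:
  assumes "isomorphic C X Y" "isomorphic C Y Z"
  shows "isomorphic C X Z"
proof -
  obtain f f' where f: "f \<in> Hom C X Y" "f' \<in> Hom C Y X" "f' \<cdot> f = Idn C X" "f \<cdot> f' = Idn C Y"
    using assms(1) unfolding isomorphic_def iso_arr_def by blast
  obtain g g' where g: "g \<in> Hom C Y Z" "g' \<in> Hom C Z Y" "g' \<cdot> g = Idn C Y" "g \<cdot> g' = Idn C Z"
    using assms(2) unfolding isomorphic_def iso_arr_def by blast
  have 1: "g \<cdot> f \<in> Hom C X Z" "f' \<cdot> g' \<in> Hom C Z X"
    using f g comp_hom by blast+
  have "(f' \<cdot> g') \<cdot> (g \<cdot> f) = f' \<cdot> ((g' \<cdot> g) \<cdot> f)"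
    by (simp add: comp_assoc[OF 1(1) g(2) f(2)] comp_assoc[OF f(1) g(1,2)])
  then have 2: "(f' \<cdot> g') \<cdot> (g \<cdot> f) = Idn C X"
    by (simp add: g(3) comp_idn_left[OF f(1)] f(3))
  have "(g \<cdot> f) \<cdot> (f' \<cdot> g') = g \<cdot> ((f \<cdot> f') \<cdot> g')"
    by (simp add: comp_assoc[OF 1(2) f(1) g(1)] comp_assoc[OF g(2) f(2,1)])
  then have "(g \<cdot> f) \<cdot> (f' \<cdot> g') = Idn C Z"
    by (simp add: f(4) comp_idn_left[OF g(2)] g(4))
  with 1 2 show ?thesis
    unfolding isomorphic_def iso_arr_def by blast
qed

lemma skeleton_exists: "\<exists>S. is_skeleton C S"
proof -
  define r where "r X = (SOME Y. Y \<in> Obj C \<and> isomorphic C X Y)" for X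
  have r: "r X \<in> Obj C \<and> isomorphic C X (r X)" if "X \<in> Obj C" for X
    unfolding r_def by (rule someI[of _ X]) (simp add: that isomorphic_refl)
  have eq: "r X = r Y" if "isomorphic C X Y" for X Y
  proof -
    have "isomorphic C X = isomorphic C Y"
      using that by (blast intro: isomorphic_sym isomorphic_trans)
    then show ?thesis by (simp add: r_def)
  qed
  have "\<exists>!Y. Y \<in> r ` Obj C \<and> isomorphic C X Y" if X: "X \<in> Obj C" for X
  proof (rule ex1I[of _ "r X"])
    fix Y assume "Y \<in> r ` Obj C \<and> isomorphic C X Y"
    then obtain Z where "Z \<in> Obj C" "Y = r Z" "isomorphic C X Y" by blast
    then show "Y = r X"
      using r[of Z] eq[of X Z] isomorphic_trans[of X Y Z] isomorphic_sym[of Z Y] by auto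
  qed (use r X in blast)
  moreover have "r ` Obj C \<subseteq> Obj C" using r by blast
  ultimately have "is_skeleton C (full_subcategory C (r ` Obj C))"
    unfolding is_skeleton_def by (intro exI[of _ "r ` Obj C"]) simp
  then show ?thesis ..
qed

end


section \<open>Functors and adjunctions\<close>

record ('o1, 'm1, 'o2, 'm2) fun_data =
  ObjMap :: "'o1 \<Rightarrow> 'o2"
  ArrMap :: "'m1 \<Rightarrow> 'm2"

locale is_functor = source: category C + target: category D
  for C :: "('o1, 'm1, 'z1) cat_scheme" and D :: "('o2, 'm2, 'z2) cat_scheme" +
  fixes F :: "('o1, 'm1, 'o2, 'm2) fun_data"
  assumes map_obj: "X \<in> Obj C \<Longrightarrow> ObjMap F X \<in> Obj D"
    and map_hom: "f \<in> Hom C X Y \<Longrightarrow> ArrMap F f \<in> Hom D (ObjMap F X) (ObjMap F Y)"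
    and map_idn: "X \<in> Obj C \<Longrightarrow> ArrMap F (Idn C X) = Idn D (ObjMap F X)"
    and map_comp: "\<lbrakk>f \<in> Hom C X Y; g \<in> Hom C Y Z\<rbrakk>
      \<Longrightarrow> ArrMap F (g \<cdot>\<^bsub>C\<^esub> f) = ArrMap F g \<cdot>\<^bsub>D\<^esub> ArrMap F f"

locale adjunction = left: is_functor C D F + right: is_functor D C G
  for C :: "('o1, 'm1, 'z1) cat_scheme" and D :: "('o2, 'm2, 'z2) cat_scheme"
    and F :: "('o1, 'm1, 'o2, 'm2) fun_data" and G :: "('o2, 'm2, 'o1, 'm1) fun_data" +
  fixes \<phi> :: "'o1 \<Rightarrow> 'o2 \<Rightarrow> 'm2 \<Rightarrow> 'm1"
  assumes bij: "\<lbrakk>X \<in> Obj C; Y \<in> Obj D\<rbrakk>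
      \<Longrightarrow> bij_betw (\<phi> X Y) (Hom D (ObjMap F X) Y) (Hom C X (ObjMap G Y))"
    and natural: "\<lbrakk>h \<in> Hom C X' X; k \<in> Hom D Y Y'; f \<in> Hom D (ObjMap F X) Y\<rbrakk>
      \<Longrightarrow> \<phi> X' Y' (k \<cdot>\<^bsub>D\<^esub> f \<cdot>\<^bsub>D\<^esub> ArrMap F h) = ArrMap G k \<cdot>\<^bsub>C\<^esub> \<phi> X Y f \<cdot>\<^bsub>C\<^esub> h"

definition has_right_adjoint ::
  "('o1, 'm1, 'z1) cat_scheme \<Rightarrow> ('o2, 'm2, 'z2) cat_scheme
     \<Rightarrow> ('o1, 'm1, 'o2, 'm2) fun_data \<Rightarrow> bool" where
  "has_right_adjoint C D F \<longleftrightarrow> (\<exists>G \<phi>. adjunction C D F G \<phi>)"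

definition product_category ::
  "('o1, 'm1, 'z1) cat_scheme \<Rightarrow> ('o2, 'm2, 'z2) cat_scheme
     \<Rightarrow> ('o1 \<times> 'o2, 'm1 \<times> 'm2) cat" where
  "product_category C D =
     \<lparr> Obj = Obj C \<times> Obj D, Arr = Arr C \<times> Arr D,
       Dom = map_prod (Dom C) (Dom D), Cod = map_prod (Cod C) (Cod D),
       Idn = map_prod (Idn C) (Idn D),
       Comp = (\<lambda>(g, g') (f, f'). (g \<cdot>\<^bsub>C\<^esub> f, g' \<cdot>\<^bsub>D\<^esub> f')) \<rparr>"


section \<open>Monoidal categories\<close>

record ('o, 'm) moncat = "('o, 'm) cat" +
  TensorObj :: "'o \<Rightarrow> 'o \<Rightarrow> 'o"  (infixr "\<boxtimes>\<index>" 80)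
  TensorArr :: "'m \<Rightarrow> 'm \<Rightarrow> 'm"  (infixr "\<otimes>\<index>" 80)
  UnitObj :: "'o"  ("\<I>\<index>")
  Assoc :: "'o \<Rightarrow> 'o \<Rightarrow> 'o \<Rightarrow> 'm"
  LUnit :: "'o \<Rightarrow> 'm"
  RUnit :: "'o \<Rightarrow> 'm"

text \<open>The tensor product is written \<open>\<boxtimes>\<close> on objects and \<open>\<otimes>\<close> on arrows.\<close>

definition tensor_functor :: "('o, 'm, 'z) moncat_scheme \<Rightarrow> ('o \<times> 'o, 'm \<times> 'm, 'o, 'm) fun_data" where
  "tensor_functor C =
     \<lparr> ObjMap = (\<lambda>(X, Y). X \<boxtimes>\<^bsub>C\<^esub> Y), ArrMap = (\<lambda>(f, g). f \<otimes>\<^bsub>C\<^esub> g) \<rparr>"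

locale monoidal_category = category C
  for C :: "('o, 'm, 'z) moncat_scheme" (structure) +
  assumes tensor_bifunctor: "is_functor (product_category C C) C (tensor_functor C)"
    and unit_obj: "\<I> \<in> Obj C"
    and assoc_iso: "\<lbrakk>X \<in> Obj C; Y \<in> Obj C; Z \<in> Obj C\<rbrakk>
      \<Longrightarrow> iso_arr C ((X \<boxtimes> Y) \<boxtimes> Z) (X \<boxtimes> (Y \<boxtimes> Z)) (Assoc C X Y Z)"
    and assoc_natural: "\<lbrakk>f \<in> Hom C X X'; g \<in> Hom C Y Y'; h \<in> Hom C Z Z'\<rbrakk>
      \<Longrightarrow> Assoc C X' Y' Z' \<cdot> ((f \<otimes> g) \<otimes> h) = (f \<otimes> (g \<otimes> h)) \<cdot> Assoc C X Y Z"
    and lunit_iso: "X \<in> Obj C \<Longrightarrow> iso_arr C (\<I> \<boxtimes> X) X (LUnit C X)"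
    and lunit_natural: "f \<in> Hom C X Y \<Longrightarrow> LUnit C Y \<cdot> (Idn C \<I> \<otimes> f) = f \<cdot> LUnit C X"
    and runit_iso: "X \<in> Obj C \<Longrightarrow> iso_arr C (X \<boxtimes> \<I>) X (RUnit C X)"
    and runit_natural: "f \<in> Hom C X Y \<Longrightarrow> RUnit C Y \<cdot> (f \<otimes> Idn C \<I>) = f \<cdot> RUnit C X"
    and pentagon: "\<lbrakk>W \<in> Obj C; X \<in> Obj C; Y \<in> Obj C; Z \<in> Obj C\<rbrakk>
      \<Longrightarrow> Assoc C W X (Y \<boxtimes> Z) \<cdot> Assoc C (W \<boxtimes> X) Y Z
        = (Idn C W \<otimes> Assoc C X Y Z) \<cdot> Assoc C W (X \<boxtimes> Y) Z \<cdot> (Assoc C W X Y \<otimes> Idn C Z)"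
    and triangle: "\<lbrakk>X \<in> Obj C; Y \<in> Obj C\<rbrakk>
      \<Longrightarrow> (Idn C X \<otimes> LUnit C Y) \<cdot> Assoc C X \<I> Y = RUnit C X \<otimes> Idn C Y"

definition is_pre_dual :: "('o, 'm, 'z) moncat_scheme \<Rightarrow> 'o \<Rightarrow> 'o \<Rightarrow> 'm \<Rightarrow> bool" where
  "is_pre_dual C X Xs ev \<longleftrightarrow>
     Xs \<in> Obj C \<and> ev \<in> Hom C (Xs \<boxtimes>\<^bsub>C\<^esub> X) \<I>\<^bsub>C\<^esub> \<and>
     (\<forall>T \<in> Obj C. bij_betw (\<lambda>u. ev \<cdot>\<^bsub>C\<^esub> (u \<otimes>\<^bsub>C\<^esub> Idn C X)) (Hom C T Xs) (Hom C (T \<boxtimes>\<^bsub>C\<^esub> X) \<I>\<^bsub>C\<^esub>))"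

definition pre_rigid :: "('o, 'm, 'z) moncat_scheme \<Rightarrow> bool" where
  "pre_rigid C \<longleftrightarrow> (\<forall>X \<in> Obj C. \<exists>Xs ev. is_pre_dual C X Xs ev)"

definition tensor_right :: "('o, 'm, 'z) moncat_scheme \<Rightarrow> 'o \<Rightarrow> ('o, 'm, 'o, 'm) fun_data" where
  "tensor_right C X = \<lparr> ObjMap = (\<lambda>T. T \<boxtimes>\<^bsub>C\<^esub> X), ArrMap = (\<lambda>f. f \<otimes>\<^bsub>C\<^esub> Idn C X) \<rparr>"

definition right_closed :: "('o, 'm, 'z) moncat_scheme \<Rightarrow> bool" where
  "right_closed C \<longleftrightarrow> (\<forall>X \<in> Obj C. has_right_adjoint C C (tensor_right C X))"

end

theory Submission
  imports Defs
begin

text \<open>Taking \<open>T = \<I>\<close> in the universal property of a pre-dual, or in the one of a right adjoint \<open>G\<close>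
  of \<open>(-) \<otimes> X\<close>, identifies \<open>Hom(X, \<I>) \<cong> Hom(\<I> \<otimes> X, \<I>)\<close> with \<open>Hom(\<I>, X\<^sup>*)\<close>, respectively
  \<open>Hom(X, Y) \<cong> Hom(\<I> \<otimes> X, Y)\<close> with \<open>Hom(\<I>, G Y)\<close>. If \<open>\<I>\<close> is initial, these are singletons:
  in the first case \<open>\<I>\<close> is terminal; in the second every hom-set is a singleton, so all objects
  are isomorphic and the skeleton is trivial. Conversely, if \<open>\<I>\<close> is terminal, then \<open>Hom(T, \<I>)\<close>
  and \<open>Hom(T \<otimes> X, \<I>)\<close> are both singletons, so any map between them is bijective.\<close>

text \<open>Phrased through cardinality, unique existence carries over along any bijection.\<close>

lemma ex1_mem_iff_card: "(\<exists>!x. x \<in> A) \<longleftrightarrow> card A = 1"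
  by (auto simp: card_1_singleton_iff)

lemma bij_betw_ex1_iff:
  assumes "bij_betw f A B"
  shows "(\<exists>!x. x \<in> A) \<longleftrightarrow> (\<exists>!y. y \<in> B)"
  unfolding ex1_mem_iff_card bij_betw_same_card[OF assms] ..

lemma bij_betw_if_ex1:
  assumes "\<exists>!x. x \<in> A" "\<exists>!y. y \<in> B" "\<And>x. x \<in> A \<Longrightarrow> f x \<in> B"
  shows "bij_betw f A B"
proof -
  obtain a b where "A = {a}" "B = {b}" using assms(1,2) by blast
  with assms(3) show ?thesis by (simp add: bij_betw_def)
qed

context category
begin

text \<open>The inverse map is precomposition with the inverse of \<open>e\<close>.\<close>

lemma bij_betw_precomp_iso:
  assumes "iso_arr C X Y e"
  shows "bij_betw (\<lambda>f. f \<cdot> e) (Hom C Y Z) (Hom C X Z)"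
proof -
  obtain g where e: "e \<in> Hom C X Y" and g: "g \<in> Hom C Y X" "g \<cdot> e = Idn C X" "e \<cdot> g = Idn C Y"
    using assms unfolding iso_arr_def by blast
  show ?thesis
  proof (rule bij_betw_byWitness[where f' = "\<lambda>f. f \<cdot> g"])
    show "\<forall>f \<in> Hom C Y Z. (f \<cdot> e) \<cdot> g = f"
      using comp_assoc[OF g(1) e] comp_idn_right g(3) by simp
    show "\<forall>f \<in> Hom C X Z. (f \<cdot> g) \<cdot> e = f"
      using comp_assoc[OF e g(1)] comp_idn_right g(2) by simp
  qed (auto intro: comp_hom[OF e] comp_hom[OF g(1)])
qed

lemma category_full_subcategory:
  assumes "A \<subseteq> Obj C"
  shows "category (full_subcategory C A)"
proof -
  \<comment> \<open>With hom-sets in this form, each category axiom reduces to the same axiom of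
    \<open>C\<close>; the empty branch disposes of objects outside \<open>A\<close>.\<close>
  have Hom_eq: "Hom (full_subcategory C A) X Y = (if X \<in> A \<and> Y \<in> A then Hom C X Y else {})" for X Y
    by (auto simp: Hom_def full_subcategory_def)
  show ?thesis
  proof (unfold_locales, unfold Hom_eq, goal_cases)
    case 1
    then show ?case by (simp add: full_subcategory_def)
  next
    case 2
    then show ?case by (simp add: full_subcategory_def)
  next
    case 3
    then show ?case using assms idn_hom by (auto simp: full_subcategory_def)
  next
    case 4
    then show ?case using comp_hom by (simp add: full_subcategory_def split: if_splits)
  next
    case 5
    then show ?case using comp_idn_right by (simp add: full_subcategory_def split: if_splits)
  next
    case 6
    then show ?case using comp_idn_left by (simp add: full_subcategory_def split: if_splits)
  next
    case 7
    then show ?case using comp_assoc by (simp add: full_subcategory_def split: if_splits)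
  qed
qed

text \<open>Singleton hom-sets leave a single isomorphism class, so a skeleton keeps one object and
  its only endomorphism. Nonemptiness excludes the empty skeleton.\<close>

lemma trivial_skeleton:
  assumes thin: "\<And>X Y. X \<in> Obj C \<Longrightarrow> Y \<in> Obj C \<Longrightarrow> \<exists>!f. f \<in> Hom C X Y"
    and nonempty: "Obj C \<noteq> {}"
    and skel: "is_skeleton C S"
  shows "trivial_category S"
proof -
  have all_iso: "isomorphic C X Y" if XY: "X \<in> Obj C" "Y \<in> Obj C" for X Y
  proof -
    obtain f g where fg: "f \<in> Hom C X Y" "g \<in> Hom C Y X"
      using thin[OF XY] thin[OF XY(2,1)] by blast
    \<comment> \<open>Each composite shares a singleton endomorphism set with an identity.\<close>
    have "g \<cdot> f = Idn C X" "f \<cdot> g = Idn C Y"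
      using thin[OF XY(1) XY(1)] comp_hom[OF fg] idn_hom[OF XY(1)]
        thin[OF XY(2) XY(2)] comp_hom[OF fg(2,1)] idn_hom[OF XY(2)] by auto
    with fg show ?thesis unfolding isomorphic_def iso_arr_def by blast
  qed
  obtain A where A: "A \<subseteq> Obj C" "\<forall>X \<in> Obj C. \<exists>!Y. Y \<in> A \<and> isomorphic C X Y"
    and S: "S = full_subcategory C A"
    using skel unfolding is_skeleton_def by blast
  obtain Y where Y: "A = {Y}" "Y \<in> Obj C"
  proof -
    obtain X where X: "X \<in> Obj C" using nonempty by blast
    then obtain Y where Y: "Y \<in> A" "\<And>Z. Z \<in> A \<Longrightarrow> isomorphic C X Z \<Longrightarrow> Z = Y"
      using A(2) by metis
    moreover have "isomorphic C X Z" if "Z \<in> A" for Z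
      using all_iso[OF X] A(1) that by blast
    ultimately have "A = {Y}" by blast
    with that A(1) show thesis by blast
  qed
  have "Arr S = Hom C Y Y"
    by (auto simp: S Y full_subcategory_def Hom_def)
  moreover have "Obj S = {Y}"
    by (simp add: S Y full_subcategory_def)
  ultimately show ?thesis
    unfolding trivial_category_def
    using thin[OF Y(2) Y(2)] category_full_subcategory[OF A(1)] by (simp add: S)
qed

end

context monoidal_category
begin

lemma tensor_obj: "X \<in> Obj C \<Longrightarrow> Y \<in> Obj C \<Longrightarrow> X \<boxtimes> Y \<in> Obj C"
  using is_functor.map_obj[OF tensor_bifunctor, of "(X, Y)"]
  by (simp add: product_category_def tensor_functor_def)

lemma tensor_hom:
  "f \<in> Hom C X X' \<Longrightarrow> g \<in> Hom C Y Y' \<Longrightarrow> f \<otimes> g \<in> Hom C (X \<boxtimes> Y) (X' \<boxtimes> Y')"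
  using is_functor.map_hom[OF tensor_bifunctor, of "(f, g)" "(X, Y)" "(X', Y')"]
  by (simp add: product_category_def tensor_functor_def Hom_def)

text \<open>Precomposition with the left unitor removes the factor \<open>\<I>\<close> that appears
  when a universal property is evaluated at \<open>T = \<I>\<close>.\<close>

lemma ex1_hom_lunit_iff:
  assumes "X \<in> Obj C"
  shows "(\<exists>!f. f \<in> Hom C (\<I> \<boxtimes> X) Y) \<longleftrightarrow> (\<exists>!f. f \<in> Hom C X Y)"
  using bij_betw_ex1_iff[OF bij_betw_precomp_iso[OF lunit_iso[OF assms]]] by (rule sym)

lemma unit_pre_dual_if_terminal:
  assumes "terminal_obj C \<I>" and X: "X \<in> Obj C"
  shows "\<exists>ev. is_pre_dual C X \<I> ev"
proof -
  have to_unit: "\<exists>!f. f \<in> Hom C T \<I>" if "T \<in> Obj C" for T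
    using assms(1) that unfolding terminal_obj_def by blast
  \<comment> \<open>Terminality leaves only one candidate for the evaluation.\<close>
  obtain ev where ev: "ev \<in> Hom C (\<I> \<boxtimes> X) \<I>"
    using to_unit tensor_obj[OF unit_obj X] by blast
  \<comment> \<open>Both sides are singletons, so it suffices that the map lands in its
    target.\<close>
  have "bij_betw (\<lambda>u. ev \<cdot> (u \<otimes> Idn C X)) (Hom C T \<I>) (Hom C (T \<boxtimes> X) \<I>)" if T: "T \<in> Obj C" for T
    using T X by (intro bij_betw_if_ex1 to_unit tensor_obj comp_hom[OF _ ev] tensor_hom idn_hom)
  with ev unit_obj show ?thesis unfolding is_pre_dual_def by blast
qed

lemma unit_terminal_if_initial_pre_rigid:
  assumes init: "initial_obj C \<I>" and "pre_rigid C"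
  shows "terminal_obj C \<I>"
proof -
  have "\<exists>!f. f \<in> Hom C X \<I>" if X: "X \<in> Obj C" for X
  proof -
    obtain Xs ev where Xs: "Xs \<in> Obj C"
      and bij: "bij_betw (\<lambda>u. ev \<cdot> (u \<otimes> Idn C X)) (Hom C \<I> Xs) (Hom C (\<I> \<boxtimes> X) \<I>)"
      using assms(2) X unit_obj unfolding pre_rigid_def is_pre_dual_def by blast
    have "\<exists>!f. f \<in> Hom C \<I> Xs"
      using init Xs unfolding initial_obj_def by blast
    then show ?thesis
      using bij_betw_ex1_iff[OF bij] ex1_hom_lunit_iff[OF X] by simp
  qed
  then show ?thesis using unit_obj unfolding terminal_obj_def by blast
qed

lemma ex1_hom_if_initial_right_closed:
  assumes init: "initial_obj C \<I>" and "right_closed C" and X: "X \<in> Obj C" and Y: "Y \<in> Obj C"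
  shows "\<exists>!f. f \<in> Hom C X Y"
proof -
  obtain G \<phi> where "adjunction C C (tensor_right C X) G \<phi>"
    using assms(2) X unfolding right_closed_def has_right_adjoint_def by blast
  then interpret adjunction C C "tensor_right C X" G \<phi> .
  have bij: "bij_betw (\<phi> \<I> Y) (Hom C (\<I> \<boxtimes> X) Y) (Hom C \<I> (ObjMap G Y))"
    using bij[OF unit_obj Y] by (simp add: tensor_right_def)
  have "\<exists>!f. f \<in> Hom C \<I> (ObjMap G Y)"
    using init right.map_obj[OF Y] unfolding initial_obj_def by blast
  then show ?thesis
    using bij_betw_ex1_iff[OF bij] ex1_hom_lunit_iff[OF X] by simp
qed

end

theorem proposition2p15:
  fixes C :: "('o, 'm) moncat"
  assumes "monoidal_category C"
  shows "(terminal_obj C \<I>\<^bsub>C\<^esub> \<longrightarrow>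
            pre_rigid C \<and> (\<forall>X \<in> Obj C. \<exists>ev. is_pre_dual C X \<I>\<^bsub>C\<^esub> ev)) \<and>
         (initial_obj C \<I>\<^bsub>C\<^esub> \<and> pre_rigid C \<longrightarrow> terminal_obj C \<I>\<^bsub>C\<^esub>) \<and>
         (\<forall>S. initial_obj C \<I>\<^bsub>C\<^esub> \<and> is_skeleton C S \<and> \<not> trivial_category S \<longrightarrow> \<not> right_closed C)"
proof -
  interpret monoidal_category C by fact
  \<comment> \<open>The third claim is proved in contrapositive form; \<open>unit_obj\<close>
    witnesses that \<open>Obj C\<close> is nonempty.\<close>
  have "trivial_category S"
    if "initial_obj C \<I>\<^bsub>C\<^esub>" "is_skeleton C S" "right_closed C" for S
    using trivial_skeleton[OF ex1_hom_if_initial_right_closed] that unit_obj by blast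
  then show ?thesis
    using unit_pre_dual_if_terminal unit_terminal_if_initial_pre_rigid
    unfolding pre_rigid_def by blast
qed

end
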